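(* Let $I_0\subset\mathbb{R}$ be a bounded interval, let $f\in\mathrm{BLO}(I_0)$ with $B=\|f\|_{\mathrm{BLO}(I_0)}>0$, and let $\lambda>0$. For a subinterval $I\subseteq I_0$ put $$x_I=\frac{f_I-\operatorname*{ess\,inf}_I f}{B}\in[0,1],\qquad L=\frac{\lambda}{B}.$$ Then $$\frac1{|I|}\left|\left\{x\in I: f(x)-\operatorname*{ess\,inf}_I f>\lambda\right\}\right|\le\mathcal B(x_I,L),$$ where $$\mathcal B(x,L)=\min\left\{1,\frac{x}{q(L)}\right\}=\begin{cases}1,&0<L\le x,\\ x/L,& x<L\le1,\\ x e^{1-L},& L\ge1,\end{cases}$$ and where at the common endpoints the adjacent formulas agree.
   Context: Intervals have positive finite length, and $|E|$ denotes Lebesgue measure. For an interval $I$, $f_I=\frac1{|I|}\int_I f(x)\,dx$. For a bounded interval $I_0$ and a real-valued $f\in L^1(I_0)$, $$\|f\|_{\mathrm{BLO}(I_0)}=\sup_{I\subseteq I_0}\left(f_I-\operatorname*{ess\,inf}_I f\right),$$ the supremum being over all subintervals $I$ of $I_0$; $f\in\mathrm{BLO}(I_0)$ means that this quantity is finite. The function $q:(0,\infty)\to(0,\infty)$ is $q(t)=t$ for $0<t\le1$ and $q(t)=e^{t-1}$ for $t\ge1$. *)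

theory Defs
  imports "HOL-Probability.Essential_Supremum"
begin

text \<open>The endpoints may or may not belong to the interval.\<close>

definition proper_interval :: "real set \<Rightarrow> bool" where
  "proper_interval I \<longleftrightarrow> is_interval I \<and> bounded I \<and> 0 < measure lebesgue I"

definition mean_on :: "real set \<Rightarrow> (real \<Rightarrow> real) \<Rightarrow> real" where
  "mean_on I f = (LINT x:I|lebesgue. f x) / measure lebesgue I"

text \<open>Extended-real valued, so that a function which is essentially unbounded below on \<open>I\<close>
  has essential infimum \<open>-\<infinity>\<close>, and hence infinite oscillation and BLO norm.\<close>

definition ess_inf_on :: "real set \<Rightarrow> (real \<Rightarrow> real) \<Rightarrow> ereal" where
  "ess_inf_on I f = - esssup (lebesgue_on I) (\<lambda>x. - ereal (f x))"

lemma ess_inf_on_eq_Sup: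
  assumes "f \<in> borel_measurable (lebesgue_on I)"
  shows "ess_inf_on I f = Sup {z. AE x in lebesgue_on I. z \<le> ereal (f x)}"
proof -
  have m: "(\<lambda>x. - ereal (f x)) \<in> borel_measurable (lebesgue_on I)"
    using assms by measurable
  have "{z. AE x in lebesgue_on I. - ereal (f x) \<le> z}
      = uminus ` {z. AE x in lebesgue_on I. z \<le> ereal (f x)}" (is "?A = uminus ` ?B")
  proof (intro set_eqI iffI)
    fix z assume "z \<in> ?A"
    then have "- z \<in> ?B" by (simp add: ereal_uminus_le_reorder del: uminus_ereal.simps)
    then have "- (- z) \<in> uminus ` ?B" by (rule imageI)
    then show "z \<in> uminus ` ?B" by simp
  next
    fix z assume "z \<in> uminus ` ?B"
    then show "z \<in> ?A" by (auto simp del: uminus_ereal.simps)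
  qed
  then show ?thesis
    unfolding ess_inf_on_def esssup_eq_AE[OF m] by (simp add: ereal_Inf_uminus_image_eq)
qed

definition lower_osc :: "real set \<Rightarrow> (real \<Rightarrow> real) \<Rightarrow> ereal" where
  "lower_osc I f = ereal (mean_on I f) - ess_inf_on I f"

definition BLO_norm :: "real set \<Rightarrow> (real \<Rightarrow> real) \<Rightarrow> ereal" where
  "BLO_norm I0 f = (SUP I \<in> {I. proper_interval I \<and> I \<subseteq> I0}. lower_osc I f)"

definition BLO :: "real set \<Rightarrow> (real \<Rightarrow> real) set" where
  "BLO I0 = {f. set_integrable lebesgue I0 f \<and> BLO_norm I0 f < \<infinity>}"

text \<open>Only arguments \<open>t > 0\<close> are meaningful.\<close>

definition q :: "real \<Rightarrow> real" where
  "q t = (if t \<le> 1 then t else exp (t - 1))"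

definition bellman :: "real \<Rightarrow> real \<Rightarrow> real" where
  "bellman x L = min 1 (x / q L)"

end

theory Submission
  imports Defs
begin

text \<open>
  Let \<open>m\<close> be the essential infimum of \<open>f\<close> on \<open>I\<close> and let \<open>\<Phi>(c)\<close> be the integral over \<open>I\<close> of
  the excess \<open>max 0 (f - c)\<close>. The heart of the matter is the inequality
  \<open>\<Phi>(c) \<le> B |{x \<in> I. c \<le> f x}|\<close> for \<open>c \<ge> m\<close> (\<open>excess_integral_le\<close>). Since the measure on the
  right is essentially \<open>- \<Phi>'(c)\<close>, this is the differential inequality \<open>\<Phi> \<le> - B \<Phi>'\<close>, and it forces
  the decay \<open>\<Phi>(s) \<le> exp (- (s - m) / B) \<Phi>(m)\<close> (\<open>excess_integral_decay\<close>), where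
  \<open>\<Phi>(m) = B x\<^sub>I |I|\<close>. Chebyshev's inequality for the excess over \<open>m\<close> gives the bound \<open>x / L\<close>.
  For \<open>L \<ge> 1\<close> the points with \<open>f > m + \<lambda>\<close> have an excess of at least \<open>B\<close> over \<open>m + \<lambda> - B\<close>, so
  Chebyshev's inequality at that level and the decay of \<open>\<Phi>\<close> give \<open>x exp (1 - L)\<close>.

  The inequality for \<open>\<Phi>\<close> says that \<open>g = f - (c + B)\<close> has nonpositive integral over
  \<open>E = {x \<in> I. c \<le> f x}\<close>. The hypothesis on \<open>f\<close> becomes a dichotomy: a subinterval either
  lies in \<open>E\<close> up to a null set, or the essential infimum of \<open>f\<close> on it is at most \<open>c\<close>, and then the
  mean of \<open>f\<close> is at most \<open>c + B\<close>, that is, the integral of \<open>g\<close> is nonpositive. That this dichotomy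
  implies the claim is \<open>set_integral_le_0_of_dichotomy\<close>. Its proof takes the largest open subset \<open>U\<close> of \<open>I\<close> that
  lies in \<open>E\<close> up to a null set. Every enlargement of a component of \<open>U\<close> within \<open>I\<close> has nonpositive integral,
  hence so has the component itself; and at almost every point outside \<open>U\<close> all short intervals have
  nonpositive integral, so \<open>g \<le> 0\<close> there by Lebesgue's differentiation theorem.
\<close>

section \<open>A dichotomy for subintervals that forces a nonpositive integral\<close>

lemma set_integral_Union_le_0:
  fixes g :: "'a \<Rightarrow> real"
  assumes "countable \<C>" "disjoint \<C>" "\<C> \<subseteq> sets M"
    and "set_integrable M (\<Union>\<C>) g"
    and le: "\<And>C. C \<in> \<C> \<Longrightarrow> (LINT x:C|M. g x) \<le> 0"
  shows "(LINT x:(\<Union>\<C>)|M. g x) \<le> 0"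
proof -
  \<comment> \<open>An enumeration by all of \<open>nat\<close>, padded with empty sets when \<open>\<C>\<close> is finite.\<close>
  define A where "A n = \<Union>{C \<in> \<C>. to_nat_on \<C> C = n}" for n
  have A: "A n = {} \<or> A n \<in> \<C>" for n
  proof (cases "\<exists>C\<in>\<C>. to_nat_on \<C> C = n")
    case True
    then obtain C where C: "C \<in> \<C>" "to_nat_on \<C> C = n" by blast
    then have "{C \<in> \<C>. to_nat_on \<C> C = n} = {C}"
      using inj_on_to_nat_on[OF assms(1)] by (auto dest: inj_onD)
    then show ?thesis using C by (simp add: A_def)
  qed (auto simp: A_def)
  have UN: "(\<Union>n. A n) = \<Union>\<C>" by (auto simp: A_def)
  have sets: "A n \<in> sets M" for n
    using A[of n] assms(3) by auto
  have disj: "A m \<inter> A n = {}" if "m \<noteq> n" for m n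
    using that assms(2) by (fastforce simp: A_def pairwise_def disjnt_def)
  have int: "set_integrable M (A n) g" for n
    by (rule set_integrable_subset[OF assms(4)]) (use sets UN in blast)+
  have A0: "(LINT x:A n|M. g x) \<le> 0" for n
    using A[of n] le by (auto simp: set_lebesgue_integral_def)
  have eq: "(\<Union>n. \<Union>i<n. A i) = \<Union>\<C>" unfolding UN[symmetric] by blast
  have "(\<lambda>n. LINT x:(\<Union>i<n. A i)|M. g x) \<longlonglongrightarrow> (LINT x:(\<Union>n. \<Union>i<n. A i)|M. g x)"
    by (rule set_integral_cont_up)
      (use sets assms(4) in \<open>auto simp: eq incseq_def intro: less_le_trans\<close>)
  moreover have "(LINT x:(\<Union>i<n. A i)|M. g x) = (\<Sum>i<n. LINT x:A i|M. g x)" for n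
    by (rule set_integral_finite_Union) (use int sets disj in \<open>auto simp: disjoint_family_on_def\<close>)
  ultimately have "(\<lambda>n. \<Sum>i<n. LINT x:A i|M. g x) \<longlonglongrightarrow> (LINT x:(\<Union>\<C>)|M. g x)"
    by (simp add: eq)
  then show ?thesis
    by (rule LIMSEQ_le_const2) (simp add: A0 sum_nonpos)
qed

lemma countable_components_of_open:
  fixes U :: "real set"
  assumes "open U"
  shows "countable (components U)"
  by (rule countable_disjoint_open_subsets)
    (use assms pairwise_disjoint_components open_components in \<open>auto simp: disjoint_def components_nonoverlap\<close>)

text \<open>
  An interval that properly contains the component \<open>C\<close> is not inside \<open>U\<close>, so \<open>g\<close> has nonpositive
  integral over it. Such intervals exist arbitrarily close to \<open>C\<close>, and the integral depends
  continuously on the endpoints. Only if \<open>C\<close> fills \<open>{a..b}\<close> up to its endpoints is there nothing to enlarge; this is the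
  case in which the integral over \<open>{a..b}\<close> matters.
\<close>
lemma integral_component_le_0:
  fixes g :: "real \<Rightarrow> real"
  assumes g: "g integrable_on {a..b}" and "integral {a..b} g \<le> 0"
    and U: "open U" "U \<subseteq> {a..b}"
    and le: "\<And>u v. \<lbrakk>a \<le> u; u < v; v \<le> b; \<not> {u<..<v} \<subseteq> U\<rbrakk> \<Longrightarrow> integral {u..v} g \<le> 0"
    and C: "C \<in> components U"
  shows "integral C g \<le> 0"
proof -
  define p q where "p = Inf C" and "q = Sup C"
  have ne: "C \<noteq> {}" and sub: "C \<subseteq> U" and conn: "connected C"
    using C in_components_nonempty in_components_subset in_components_connected by blast+
  have opC: "open C" using C U open_components by blast
  have bdd: "bdd_below C" "bdd_above C"
    using sub U by (meson bdd_below_mono bdd_below_Icc order_trans, meson bdd_above_mono bdd_above_Icc order_trans)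
  have Csub: "C \<subseteq> {p..q}"
    using bdd by (auto simp: p_def q_def cInf_lower cSup_upper)
  have sup: "{p<..<q} \<subseteq> C"
  proof
    fix x assume x: "x \<in> {p<..<q}"
    obtain y z where "y \<in> C" "y < x" "z \<in> C" "x < z"
      using x ne bdd unfolding p_def q_def
      by (metis cInf_less_iff greaterThanLessThan_iff less_cSup_iff)
    then show "x \<in> C"
      using conn by (meson connected_iff_interval less_imp_le)
  qed
  have pq: "p < q"
  proof (rule ccontr)
    assume "\<not> p < q"
    then have "C \<subseteq> {p}" using Csub by auto
    with ne have "C = {p}" by auto
    with opC show False by (simp add: not_open_singleton)
  qed
  have ab: "a \<le> p" "q \<le> b"
    using sub U ne by (auto simp: p_def q_def intro!: cInf_greatest cSup_least)
  have wider: "integral {u..v} g \<le> 0" if "a \<le> u" "u \<le> p" "q \<le> v" "v \<le> b" "u < p \<or> q < v" for u v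
  proof (rule le)
    show "\<not> {u<..<v} \<subseteq> U"
    proof
      assume UU: "{u<..<v} \<subseteq> U"
      have "(p+q)/2 \<in> C \<inter> {u<..<v}" using sup that pq by auto
      then have "{u<..<v} \<subseteq> C" using components_maximal[OF C _ UU] by fastforce
      then have s: "{u<..<v} \<subseteq> {p..q}" using Csub by auto
      then have "p \<le> u \<and> v \<le> q"
        using that pq by (simp add: greaterThanLessThan_subseteq_atLeastAtMost_iff)
      then show False using that by auto
    qed
  qed (use that pq in auto)
  have "integral {p..q} g \<le> 0"
  proof (cases "p = a")
    case False
    then have pa: "a < p" using ab by simp
    have "continuous_on {a..p} (\<lambda>u. integral {u..q} g)"
      by (rule continuous_on_subset[OF indefinite_integral_continuous_1'[of g a q]])
        (use integrable_subinterval_real[OF g] ab pq in auto)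
    then show ?thesis
      using continuous_le_on_closure[of "{a..<p}" "\<lambda>u. integral {u..q} g" p 0] wider pa ab by auto
  next
    case pa: True
    show ?thesis
    proof (cases "q = b")
      case False
      then have "q < b" using ab by simp
      have "continuous_on {q..b} (\<lambda>v. integral {p..v} g)"
        by (rule continuous_on_subset[OF indefinite_integral_continuous_1[of g p b]])
          (use integrable_subinterval_real[OF g] ab pq pa in auto)
      then show ?thesis
        using continuous_le_on_closure[of "{q<..b}" "\<lambda>v. integral {p..v} g" q 0] wider \<open>q < b\<close> ab pa by auto
    qed (use pa assms(2) in simp)
  qed
  also have "integral {p..q} g = integral C g"
    by (rule integral_spike_set; rule negligible_subset[of "{p,q}"])
      (use Csub sup in \<open>force+\<close>)
  finally show ?thesis .
qed

text \<open>
  At almost every \<open>x\<close> the averages of \<open>g\<close> over \<open>{x..x + h}\<close> tend to \<open>g x\<close> as \<open>h\<close> decreases to 0. For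
  \<open>x\<close> outside \<open>U\<close>, the interval \<open>{x<..<x + h}\<close> can be contained in \<open>U\<close> only if \<open>x\<close> is the left endpoint
  of a component of \<open>U\<close>, and there are countably many of those.
\<close>
lemma nonpos_outside:
  fixes g :: "real \<Rightarrow> real"
  assumes g: "g integrable_on {a..b}"
    and U: "open U"
    and le: "\<And>u v. \<lbrakk>a \<le> u; u < v; v \<le> b; \<not> {u<..<v} \<subseteq> U\<rbrakk> \<Longrightarrow> integral {u..v} g \<le> 0"
  shows "negligible {x \<in> {a..b} - U. g x > 0}"
proof -
  \<comment> \<open>The differentiation theorem wants a function that is integrable on every interval.\<close>
  define g' where "g' x = (if x \<in> {a..b} then g x else 0)" for x
  have "g' integrable_on UNIV"
    unfolding g'_def using g integrable_restrict_UNIV by blast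
  then have "g' integrable_on cbox c d" for c d
    by (rule integrable_on_subcbox) auto
  then obtain N where N: "negligible N"
    "\<And>x e. \<lbrakk>x \<notin> N; 0 < e\<rbrakk> \<Longrightarrow> \<exists>d>0. \<forall>h. 0 < h \<and> h < d \<longrightarrow> \<bar>integral {x..x+h} g' / h - g' x\<bar> < e"
    using integrable_ccontinuous_explicit[of g'] by (auto simp: divide_inverse mult.commute)
  have "countable (components U)"
    using U(1) by (rule countable_components_of_open)
  then have small: "negligible (N \<union> Inf ` components U \<union> {b})"
    using N by (auto intro!: negligible_Un simp: negligible_iff_null_sets countable_imp_null_set_lborel null_sets_completionI)
  have "g x \<le> 0" if x: "x \<in> {a..b} - U" "x \<notin> N" "x \<notin> Inf ` components U" "x \<noteq> b" for x
  proof (rule ccontr)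
    assume "\<not> g x \<le> 0"
    then have gx: "g x > 0" "g' x = g x" using x by (auto simp: g'_def)
    obtain d where d: "d > 0" "\<And>h. 0 < h \<and> h < d \<Longrightarrow> \<bar>integral {x..x+h} g' / h - g' x\<bar> < g x"
      using N(2)[OF x(2) gx(1)] by blast
    \<comment> \<open>Short enough for the average over \<open>{x..x + h}\<close> to be close to \<open>g x\<close> and to stay inside \<open>{a..b}\<close>.\<close>
    define h where "h = min (d/2) (b - x)"
    have h: "0 < h" "h < d" "x + h \<le> b" using d x by (auto simp: h_def)
    have "\<not> {x<..<x+h} \<subseteq> U"
    proof
      assume s: "{x<..<x+h} \<subseteq> U"
      then obtain C where C: "C \<in> components U" "{x<..<x+h} \<subseteq> C"
        using exists_component_superset[of "{x<..<x+h}" U] h by force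
      have xC: "x \<notin> C" using C(1) x(1) in_components_subset by blast
      have mid: "x + h/2 \<in> C" using C(2) h by auto
      have low: "x \<le> y" if "y \<in> C" for y
      proof (rule ccontr)
        assume "\<not> x \<le> y"
        then have "x \<in> C"
          using in_components_connected[OF C(1)] mid that h unfolding connected_iff_interval
          by (meson add_increasing2 half_gt_zero less_imp_le linorder_linear order_refl)
        then show False using xC by simp
      qed
      have "Inf C = x"
      proof (rule cInf_eq_non_empty)
        fix y assume y: "\<And>z. z \<in> C \<Longrightarrow> y \<le> z"
        show "y \<le> x"
        proof (rule dense_ge_bounded[of x "x+h"])
          fix w assume "x < w" "w < x + h"
          then show "y \<le> w" using y C(2) by auto
        qed (use h in auto)
      qed (use low mid in auto)
      then show False using x(3) C(1) by auto
    qed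
    then have "integral {x..x+h} g \<le> 0" using le[of x "x+h"] h x by auto
    moreover have "integral {x..x+h} g' = integral {x..x+h} g"
      using h x by (intro integral_cong) (auto simp: g'_def)
    ultimately have "integral {x..x+h} g' / h \<le> 0" using h by (simp add: divide_nonpos_pos)
    then show False using d(2)[of h] h gx by auto
  qed
  then have "{x \<in> {a..b} - U. g x > 0} \<subseteq> N \<union> Inf ` components U \<union> {b}"
    by force
  then show ?thesis using small negligible_subset by blast
qed

text \<open>
  The integral over \<open>U\<close> is the sum of the integrals over the components of \<open>U\<close>, and on the rest of \<open>F\<close>
  the function itself is nonpositive almost everywhere.
\<close>
lemma set_integral_le_0_of_open:
  fixes g :: "real \<Rightarrow> real"
  assumes g: "set_integrable lebesgue {a..b} g" and "integral {a..b} g \<le> 0"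
    and U: "open U" "U \<subseteq> F" and F: "F \<subseteq> {a..b}" "F \<in> sets lebesgue"
    and le: "\<And>u v. \<lbrakk>a \<le> u; u < v; v \<le> b; \<not> {u<..<v} \<subseteq> U\<rbrakk> \<Longrightarrow> integral {u..v} g \<le> 0"
  shows "(LINT x:F|lebesgue. g x) \<le> 0"
proof -
  have Us: "U \<in> sets lebesgue" using U by auto
  have FU: "F - U \<in> sets lebesgue" using F(2) Us by (rule sets.Diff)
  have int: "set_integrable lebesgue S g" if "S \<in> sets lebesgue" "S \<subseteq> F" for S
    by (rule set_integrable_subset[OF g]) (use that F in auto)
  have gi: "g integrable_on {a..b}" using g set_lebesgue_integral_eq_integral by blast
  have comp: "C \<in> sets lebesgue" if "C \<in> components U" for C
    using open_components[OF U(1) that] by (simp add: borel_open)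
  have "(LINT x:(\<Union>(components U))|lebesgue. g x) \<le> 0"
  proof (rule set_integral_Union_le_0)
    show "countable (components U)" using U(1) by (rule countable_components_of_open)
    show "disjoint (components U)" by (auto simp: disjoint_def components_nonoverlap)
    show "set_integrable lebesgue (\<Union>(components U)) g" using int[of U] Us U by simp
    fix C assume C: "C \<in> components U"
    have "C \<subseteq> F" using C U in_components_subset by blast
    then have "(LINT x:C|lebesgue. g x) = integral C g"
      using set_lebesgue_integral_eq_integral(2)[OF int[OF comp[OF C]]] by simp
    also have "\<dots> \<le> 0"
      by (rule integral_component_le_0[OF gi assms(2) U(1) _ le C]) (use U F in auto)
    finally show "(LINT x:C|lebesgue. g x) \<le> 0" .
  qed (use comp in auto)
  then have 1: "(LINT x:U|lebesgue. g x) \<le> 0" by simp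
  have "AE x in lebesgue. x \<notin> {x \<in> {a..b} - U. g x > 0}"
    by (intro AE_not_in) (use nonpos_outside[OF gi U(1) le] in \<open>simp add: negligible_iff_null_sets\<close>)
  then have "AE x in lebesgue. x \<in> F - U \<longrightarrow> g x \<le> 0"
    by eventually_elim (use F in force)
  then have 2: "(LINT x:F-U|lebesgue. g x) \<le> 0"
    using set_integral_mono_AE[of lebesgue "F - U" g "\<lambda>_. 0"] int[OF FU]
    by (simp add: set_integrable_def)
  have "(LINT x:U \<union> (F - U)|lebesgue. g x) = (LINT x:U|lebesgue. g x) + (LINT x:F-U|lebesgue. g x)"
    by (rule set_integral_Un) (use int[OF Us] int[OF FU] U in auto)
  then show ?thesis using 1 2 U by (simp add: Un_absorb1)
qed

text \<open>
  The set \<open>U\<close> in the proof is the largest open subset of the interval that lies in \<open>E\<close> up to a null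
  set. As a union of countably many rational intervals, it exceeds \<open>E\<close> only by a null set, while an
  interval that is not contained in \<open>U\<close> is not almost contained in \<open>E\<close>, so that the dichotomy yields a
  nonpositive integral over it.
\<close>
lemma set_integral_le_0_of_dichotomy:
  fixes g :: "real \<Rightarrow> real"
  assumes g: "set_integrable lebesgue {a..b} g" and "integral {a..b} g \<le> 0"
    and E: "E \<in> sets lebesgue" "E \<subseteq> {a..b}"
    and dich: "\<And>u v. \<lbrakk>a \<le> u; u < v; v \<le> b\<rbrakk> \<Longrightarrow> negligible ({u<..<v} - E) \<or> integral {u..v} g \<le> 0"
  shows "(LINT x:E|lebesgue. g x) \<le> 0"
proof -
  define P where "P = {(p,q) \<in> \<rat> \<times> \<rat>. a \<le> p \<and> q \<le> b \<and> negligible ({p<..<q} - E)}"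
  define U where "U = (\<Union>(p,q)\<in>P. {p<..<q})"
  have "countable P" unfolding P_def
    by (rule countable_subset[of _ "\<rat> \<times> \<rat>"]) (auto intro: countable_rat)
  have "open U" unfolding U_def by auto
  have "U \<subseteq> {a..b}" by (auto simp: U_def P_def)
  have "U - E = (\<Union>(p,q)\<in>P. {p<..<q} - E)" by (auto simp: U_def)
  also have "negligible \<dots>"
    using \<open>countable P\<close> by (intro negligible_countable_Union) (auto simp: P_def)
  finally have UE: "negligible (U - E)" .
  have good: "{u<..<v} \<subseteq> U" if "a \<le> u" "v \<le> b" "negligible ({u<..<v} - E)" for u v
  proof
    fix x assume "x \<in> {u<..<v}"
    then obtain p q where pq: "p \<in> \<rat>" "q \<in> \<rat>" "u < p" "p < x" "x < q" "q < v"
      using Rats_dense_in_real by (metis greaterThanLessThan_iff)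
    have "negligible ({p<..<q} - E)"
      by (rule negligible_subset[OF that(3)]) (use pq in auto)
    then have "(p,q) \<in> P" using pq that by (auto simp: P_def)
    then show "x \<in> U" using pq by (auto simp: U_def intro!: bexI[of _ "(p,q)"])
  qed
  \<comment> \<open>\<open>E\<close> is enlarged by a null set so that it contains \<open>U\<close> literally.\<close>
  have "(LINT x:E \<union> U|lebesgue. g x) \<le> 0"
  proof (rule set_integral_le_0_of_open[OF g assms(2) \<open>open U\<close>])
    show "integral {u..v} g \<le> 0" if "a \<le> u" "u < v" "v \<le> b" "\<not> {u<..<v} \<subseteq> U" for u v
      using dich good that by blast
  qed (use E \<open>U \<subseteq> {a..b}\<close> \<open>open U\<close> in auto)
  moreover have "(LINT x:E \<union> U|lebesgue. g x) = (LINT x:E|lebesgue. g x)"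
  proof -
    have s: "E \<union> U \<in> sets lebesgue" using E \<open>open U\<close> by auto
    have i: "set_integrable lebesgue E g" "set_integrable lebesgue (E \<union> U) g"
      by (rule set_integrable_subset[OF g]; use E s \<open>U \<subseteq> {a..b}\<close> in auto)+
    have "integral (E \<union> U) g = integral E g"
      by (rule integral_spike_set; rule negligible_subset[OF UE]) auto
    then show ?thesis using i set_lebesgue_integral_eq_integral by metis
  qed
  ultimately show ?thesis by simp
qed

section \<open>Means and essential infima on intervals\<close>

lemma proper_interval_bounds:
  assumes "proper_interval I"
  obtains a b where "a < b" "{a<..<b} \<subseteq> I" "I \<subseteq> {a..b}"
proof -
  have I: "is_interval I" "bounded I" "measure lebesgue I > 0" "I \<noteq> {}"
    using assms by (auto simp: proper_interval_def)
  have bdd: "bdd_below I" "bdd_above I"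
    using I by (auto simp: bounded_imp_bdd_below bounded_imp_bdd_above)
  have sup: "{Inf I<..<Sup I} \<subseteq> I"
  proof
    fix x assume x: "x \<in> {Inf I<..<Sup I}"
    obtain y z where "y \<in> I" "y < x" "z \<in> I" "x < z"
      using x \<open>I \<noteq> {}\<close> bdd
      by (metis cInf_less_iff greaterThanLessThan_iff less_cSup_iff)
    then show "x \<in> I"
      using I(1) unfolding is_interval_1 by (meson less_imp_le)
  qed
  have sub: "I \<subseteq> {Inf I..Sup I}"
    using bdd by (auto simp: cInf_lower cSup_upper)
  have "Inf I < Sup I"
  proof (rule ccontr)
    assume "\<not> Inf I < Sup I"
    then have "I \<subseteq> {Inf I}" using sub by auto
    then have "negligible I" using negligible_subset by blast
    then show False using I(3) by (simp add: negligible_imp_measure0)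
  qed
  then show ?thesis using that sup sub by blast
qed

lemma proper_interval_lmeasurable: "proper_interval I \<Longrightarrow> I \<in> lmeasurable"
  by (simp add: is_interval_convex_1 proper_interval_def measurable_convex)

lemma proper_interval_greaterThanLessThan: "u < v \<Longrightarrow> proper_interval {u<..<v}"
  by (simp add: proper_interval_def)

lemma set_integral_const_lmeasurable:
  fixes c :: real
  assumes "A \<in> lmeasurable"
  shows "(LINT x:A|lebesgue. c) = c * measure lebesgue A"
  using assms by (subst set_integral_const) (auto simp: fmeasurable_def)

lemma ess_inf_on_AE:
  assumes "I \<in> sets lebesgue"
  shows "AE x in lebesgue. x \<in> I \<longrightarrow> ess_inf_on I f \<le> ereal (f x)"
proof -
  have "AE x in lebesgue_on I. - ereal (f x) \<le> esssup (lebesgue_on I) (\<lambda>x. - ereal (f x))"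
    by (rule esssup_AE)
  then have "AE x in lebesgue_on I. ess_inf_on I f \<le> ereal (f x)"
    unfolding ess_inf_on_def by eventually_elim (metis ereal_uminus_le_reorder)
  then show ?thesis using assms by (simp add: AE_restrict_space_iff)
qed

lemma ess_inf_on_le_mean_on:
  assumes "proper_interval I" "set_integrable lebesgue I f"
  shows "ess_inf_on I f \<le> ereal (mean_on I f)"
proof -
  have I: "I \<in> lmeasurable" "measure lebesgue I > 0"
    using assms proper_interval_lmeasurable by (auto simp: proper_interval_def)
  have real: "z \<le> mean_on I f" if "ereal z \<le> ess_inf_on I f" for z
  proof -
    have "AE x in lebesgue. x \<in> I \<longrightarrow> z \<le> f x"
      using ess_inf_on_AE[of I f] I that by (auto elim!: eventually_mono dest: order_trans)
    then have "(LINT x:I|lebesgue. z) \<le> (LINT x:I|lebesgue. f x)"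
      using I assms by (intro set_integral_mono_AE) auto
    then show ?thesis
      using I by (simp add: set_integral_const_lmeasurable mean_on_def field_simps)
  qed
  show ?thesis
  proof (cases "ess_inf_on I f")
    case PInf
    then show ?thesis using real[of "mean_on I f + 1"] by simp
  qed (use real in auto)
qed

text \<open>
  The bound by the finite \<open>B\<close> excludes the essential infimum \<open>-\<infinity>\<close>, for which the oscillation is infinite.
\<close>
lemma set_integral_le_of_lower_osc_le:
  assumes "proper_interval K" "lower_osc K f \<le> ereal B" "ess_inf_on K f \<le> ereal c"
  shows "(LINT x:K|lebesgue. f x) \<le> (c + B) * measure lebesgue K"
proof -
  have "mean_on K f \<le> c + B"
    using assms(2,3) unfolding lower_osc_def by (cases "ess_inf_on K f") auto
  then show ?thesis
    using assms(1) by (simp add: mean_on_def proper_interval_def field_simps)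
qed

lemma sets_superlevel:
  fixes f :: "real \<Rightarrow> real"
  assumes "I \<in> sets lebesgue" "set_integrable lebesgue I f"
  shows "{x \<in> I. c \<le> f x} \<in> sets lebesgue" and "{x \<in> I. c < f x} \<in> sets lebesgue"
proof -
  have [measurable]: "f \<in> borel_measurable (lebesgue_on I)"
    using absolutely_integrable_measurable[OF assms(1), THEN iffD1, OF assms(2)] ..
  have "{x \<in> space (lebesgue_on I). c \<le> f x} \<in> sets (lebesgue_on I)"
    and "{x \<in> space (lebesgue_on I). c < f x} \<in> sets (lebesgue_on I)"
    by measurable
  then show "{x \<in> I. c \<le> f x} \<in> sets lebesgue" and "{x \<in> I. c < f x} \<in> sets lebesgue"
    using assms by (simp_all add: sets_restrict_space_iff)
qed

lemma set_integrable_excess: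
  fixes f :: "real \<Rightarrow> real"
  assumes "I \<in> lmeasurable" "set_integrable lebesgue I f"
  shows "set_integrable lebesgue I (\<lambda>x. max 0 (f x - c))"
  by (intro absolutely_integrable_max_1 set_integral_diff assms absolutely_integrable_on_const)

section \<open>Decay of the excess integral\<close>

text \<open>
  With \<open>g = f - (c + B)\<close> and \<open>E = {x \<in> I. c \<le> f x}\<close> the claim reads \<open>(LINT x:E|lebesgue. g x) \<le> 0\<close>.
  On a subinterval either \<open>f \<ge> c\<close> almost everywhere, or the essential infimum is at most \<open>c\<close> and the
  bound on the oscillation keeps the mean of \<open>f\<close> at or below \<open>c + B\<close>.
\<close>
lemma excess_integral_le:
  fixes f :: "real \<Rightarrow> real"
  assumes I: "proper_interval I" and f: "set_integrable lebesgue I f"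
    and osc: "\<And>K. \<lbrakk>proper_interval K; K \<subseteq> I\<rbrakk> \<Longrightarrow> lower_osc K f \<le> ereal B"
    and c: "ess_inf_on I f \<le> ereal c"
  shows "(LINT x:I|lebesgue. max 0 (f x - c)) \<le> B * measure lebesgue {x \<in> I. c \<le> f x}"
proof -
  obtain a b where ab: "a < b" "{a<..<b} \<subseteq> I" "I \<subseteq> {a..b}"
    using proper_interval_bounds[OF I] .
  have Im: "I \<in> lmeasurable" using I by (rule proper_interval_lmeasurable)
  define g where "g x = f x - (c + B)" for x
  define E where "E = {x \<in> I. c \<le> f x}"
  have Es: "E \<in> sets lebesgue" "E \<subseteq> I"
    using sets_superlevel[of I f c] Im f by (auto simp: E_def)
  have Em: "E \<in> lmeasurable" using Es Im fmeasurableI2 by blast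
  have gI: "set_integrable lebesgue I g"
    unfolding g_def using f Im by (intro set_integral_diff) auto
  have nearly: "negligible ({a..b} - I)"
    by (rule negligible_subset[of "{a,b}"]) (use ab in force)+
  have gab: "set_integrable lebesgue {a..b} g"
  proof (rule absolutely_integrable_spike_set_eq[THEN iffD1, OF _ _ gI])
    show "negligible {x \<in> I - {a..b}. g x \<noteq> 0}"
      by (rule negligible_subset[of "{}"]) (use ab in auto)
    show "negligible {x \<in> {a..b} - I. g x \<noteq> 0}"
      by (rule negligible_subset[OF nearly]) auto
  qed
  have g_int: "(LINT x:K|lebesgue. g x) \<le> 0"
    if K: "proper_interval K" "K \<subseteq> I" "ess_inf_on K f \<le> ereal c" for K
  proof -
    have "K \<in> lmeasurable" using K proper_interval_lmeasurable by blast
    moreover from this have "set_integrable lebesgue K f"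
      using set_integrable_subset[OF f] K by auto
    ultimately have "(LINT x:K|lebesgue. g x) = (LINT x:K|lebesgue. f x) - (c + B) * measure lebesgue K"
      unfolding g_def by (subst set_integral_diff) (auto simp: set_integral_const_lmeasurable algebra_simps)
    then show ?thesis
      using set_integral_le_of_lower_osc_le[OF K(1) osc K(3)] K by simp
  qed
  have "(LINT x:E|lebesgue. g x) \<le> 0"
  proof (rule set_integral_le_0_of_dichotomy[OF gab])
    have "integral {a..b} g = integral I g"
      by (rule integral_spike_set; rule negligible_subset[OF nearly]) (use ab in auto)
    also have "\<dots> \<le> 0"
      using g_int[OF I _ c] set_lebesgue_integral_eq_integral(2)[OF gI] by simp
    finally show "integral {a..b} g \<le> 0" .
    show "E \<subseteq> {a..b}" using Es ab by blast
    fix u v assume uv: "a \<le> u" "u < v" "v \<le> b"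
    let ?K = "{u<..<v}"
    have KI: "?K \<subseteq> I" using uv ab by auto
    show "negligible (?K - E) \<or> integral {u..v} g \<le> 0"
    proof (cases "ess_inf_on ?K f \<le> ereal c")
      case True
      have "set_integrable lebesgue ?K g"
        using set_integrable_subset[OF gI] KI by auto
      then have "integral ?K g \<le> 0"
        using g_int[OF proper_interval_greaterThanLessThan KI True] uv
        by (simp add: set_lebesgue_integral_eq_integral(2))
      then show ?thesis by (simp add: integral_open_interval_real)
    next
      case False
      have "AE x in lebesgue. x \<in> ?K \<longrightarrow> ess_inf_on ?K f \<le> ereal (f x)"
        by (rule ess_inf_on_AE) simp
      then have "AE x in lebesgue. x \<notin> ?K - E"
      proof eventually_elim
        case (elim x)
        have "x \<in> E" if "x \<in> ?K"
        proof -
          have "ereal c < ereal (f x)" using False elim that by (meson less_le_trans not_le)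
          then show ?thesis using that KI by (auto simp: E_def)
        qed
        then show ?case by blast
      qed
      then obtain N where N: "N \<in> null_sets lebesgue" "{x \<in> space lebesgue. \<not> x \<notin> ?K - E} \<subseteq> N"
        unfolding eventually_ae_filter by blast
      have "negligible (?K - E)"
        by (rule negligible_subset[of N]) (use N in \<open>auto simp: negligible_iff_null_sets\<close>)
      then show ?thesis ..
    qed
  qed (rule Es)
  moreover have "(LINT x:E|lebesgue. g x) = (LINT x:E|lebesgue. f x - c) - B * measure lebesgue E"
  proof -
    have "set_integrable lebesgue E f" using set_integrable_subset[OF f] Es by auto
    then have "(LINT x:E|lebesgue. (f x - c) - B) = (LINT x:E|lebesgue. f x - c) - (LINT x:E|lebesgue. B)"
      using Em by (intro set_integral_diff) auto
    then show ?thesis using Em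
      by (simp add: g_def set_integral_const_lmeasurable algebra_simps)
  qed
  moreover have "(LINT x:I|lebesgue. max 0 (f x - c)) = (LINT x:E|lebesgue. f x - c)"
    unfolding set_lebesgue_integral_def
    by (rule Bochner_Integration.integral_cong) (auto simp: E_def indicator_def)
  ultimately show ?thesis by (simp add: E_def)
qed

text \<open>
  The hypothesis is the implicit Euler discretisation of \<open>\<Phi> \<le> - B \<Phi>'\<close>; iterating it over \<open>n\<close> equal
  steps gives the factor \<open>(1 + t / n) ^ n\<close>, which tends to \<open>exp t\<close>.
\<close>
lemma exp_decay_of_step:
  fixes \<Phi> :: "real \<Rightarrow> real"
  assumes step: "\<And>c c'. \<lbrakk>m \<le> c; c \<le> c'\<rbrakk> \<Longrightarrow> (1 + (c' - c) / B) * \<Phi> c' \<le> \<Phi> c"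
    and "B > 0" "m \<le> s"
  shows "\<Phi> s \<le> exp (- (s - m) / B) * \<Phi> m"
proof -
  define t where "t = (s - m) / B"
  have t: "t \<ge> 0" using assms by (simp add: t_def)
  have "(1 + t / real n) ^ n * \<Phi> s \<le> \<Phi> m" if n: "n > 0" for n
  proof -
    define h where "h = (s - m) / real n"
    have h: "h \<ge> 0" "h / B = t / real n" using assms by (auto simp: h_def t_def)
    have "(1 + t / real n) ^ k * \<Phi> (m + real k * h) \<le> \<Phi> m" for k
    proof (induction k)
      case (Suc k)
      have "(1 + t / real n) * \<Phi> (m + real (Suc k) * h) \<le> \<Phi> (m + real k * h)"
        using step[of "m + real k * h" "m + real (Suc k) * h"] h by (simp add: algebra_simps)
      then have "(1 + t / real n) ^ k * ((1 + t / real n) * \<Phi> (m + real (Suc k) * h))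
          \<le> (1 + t / real n) ^ k * \<Phi> (m + real k * h)"
        using t by (intro mult_left_mono) auto
      then show ?case using Suc by (simp add: mult_ac)
    qed simp
    from this[of n] show ?thesis using n by (simp add: h_def)
  qed
  moreover have "(\<lambda>n. (1 + t / real n) ^ n * \<Phi> s) \<longlonglongrightarrow> exp t * \<Phi> s"
    by (intro tendsto_intros tendsto_exp_limit_sequentially)
  ultimately have "exp t * \<Phi> s \<le> \<Phi> m"
    by (intro LIMSEQ_le_const2[where X = "\<lambda>n. (1 + t / real n) ^ n * \<Phi> s"] exI[of _ 1]) auto
  then have "\<Phi> s \<le> \<Phi> m / exp t" by (simp add: field_simps)
  moreover have "- (s - m) / B = - t" unfolding t_def by (rule minus_divide_left[symmetric])
  ultimately show ?thesis by (simp only: exp_minus) (simp add: field_simps)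
qed

text \<open>
  Raising the level from \<open>c\<close> to \<open>c'\<close> lowers the excess by the full \<open>c' - c\<close> wherever \<open>f \<ge> c'\<close>, and by
  \<open>excess_integral_le\<close> the measure of that set is at least \<open>1 / B\<close> times the excess integral at level \<open>c'\<close>.
\<close>
lemma excess_integral_decay:
  fixes f :: "real \<Rightarrow> real"
  assumes I: "proper_interval I" and f: "set_integrable lebesgue I f"
    and osc: "\<And>K. \<lbrakk>proper_interval K; K \<subseteq> I\<rbrakk> \<Longrightarrow> lower_osc K f \<le> ereal B"
    and m: "ess_inf_on I f \<le> ereal m" and "B > 0" "m \<le> s"
  shows "(LINT x:I|lebesgue. max 0 (f x - s))
    \<le> exp (- (s - m) / B) * (LINT x:I|lebesgue. max 0 (f x - m))"
proof (rule exp_decay_of_step[of m B "\<lambda>c. LINT x:I|lebesgue. max 0 (f x - c)"])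
  fix c c' assume c: "m \<le> c" "c \<le> c'"
  have Im: "I \<in> lmeasurable" using I by (rule proper_interval_lmeasurable)
  define E where "E = {x \<in> I. c' \<le> f x}"
  have E: "E \<in> sets lebesgue" "E \<subseteq> I"
    using sets_superlevel[of I f c'] Im f by (auto simp: E_def)
  have Em: "E \<in> lmeasurable" using E Im fmeasurableI2 by blast
  have int: "set_integrable lebesgue I (\<lambda>x. (c' - c) * indicator E x)"
    by (rule set_integrable_mult_right)
      (use Em E in \<open>simp add: set_integrable_def indicator_inter_arith[symmetric] Int_absorb1 fmeasurable_def\<close>)
  have "(LINT x:I|lebesgue. (c' - c) * indicator E x) = (c' - c) * measure lebesgue E"
    using E by (simp add: set_lebesgue_integral_def indicator_inter_arith[symmetric] Int_absorb1)
  moreover have "(c' - c) / B * (LINT x:I|lebesgue. max 0 (f x - c')) \<le> (c' - c) * measure lebesgue E"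
  proof -
    have "ess_inf_on I f \<le> ereal c'" using m c by (meson ereal_less_eq(3) order_trans)
    then have "(LINT x:I|lebesgue. max 0 (f x - c')) \<le> B * measure lebesgue E"
      unfolding E_def by (intro excess_integral_le[OF I f] osc)
    then have "(c' - c) / B * (LINT x:I|lebesgue. max 0 (f x - c')) \<le> (c' - c) / B * (B * measure lebesgue E)"
      using c \<open>B > 0\<close> by (intro mult_left_mono) auto
    then show ?thesis using \<open>B > 0\<close> by simp
  qed
  moreover have "(LINT x:I|lebesgue. max 0 (f x - c')) + (LINT x:I|lebesgue. (c' - c) * indicator E x)
      = (LINT x:I|lebesgue. max 0 (f x - c') + (c' - c) * indicator E x)"
    using set_integrable_excess[OF Im f] int by (simp add: set_integral_add)
  moreover have "\<dots> \<le> (LINT x:I|lebesgue. max 0 (f x - c))"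
    using set_integrable_excess[OF Im f] int c
    by (intro set_integral_mono set_integral_add) (auto simp: E_def indicator_def)
  ultimately show "(1 + (c' - c) / B) * (LINT x:I|lebesgue. max 0 (f x - c'))
      \<le> (LINT x:I|lebesgue. max 0 (f x - c))"
    by (simp add: algebra_simps)
qed (use assms in auto)

text \<open>
  Chebyshev's inequality for the excess over any lower level \<open>s\<close>; the choice of \<open>s\<close> is what
  distinguishes the linear from the exponential regime.
\<close>
lemma measure_superlevel_le:
  fixes f :: "real \<Rightarrow> real"
  assumes I: "I \<in> lmeasurable" and f: "set_integrable lebesgue I f" and "s < t"
  shows "measure lebesgue {x \<in> I. t < f x} \<le> (LINT x:I|lebesgue. max 0 (f x - s)) / (t - s)"
proof -
  have "measure lebesgue {x \<in> I. t < f x} \<le> measure lebesgue {x \<in> I. t - s \<le> max 0 (f x - s)}"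
  proof (rule measure_mono_fmeasurable)
    show "{x \<in> I. t < f x} \<in> sets lebesgue"
      using sets_superlevel(2)[OF fmeasurableD[OF I] f] .
    have "{x \<in> I. t - s \<le> max 0 (f x - s)} \<in> sets lebesgue"
      by (rule sets_superlevel(1)) (use I set_integrable_excess[OF I f] in auto)
    then show "{x \<in> I. t - s \<le> max 0 (f x - s)} \<in> lmeasurable"
      by (intro fmeasurableI2[OF I]) auto
  qed auto
  also have "\<dots> \<le> (LINT x:I|lebesgue. max 0 (f x - s)) / (t - s)"
    by (rule integral_Markov_inequality'_measure) (use assms set_integrable_excess[OF I f] in auto)
  finally show ?thesis .
qed

section \<open>The distribution estimate\<close>

theorem theorem2p9:
  fixes f :: "real \<Rightarrow> real" and I0 I :: "real set" and B lam :: real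
  assumes "proper_interval I0"
    and "f \<in> BLO I0"
    and "B = real_of_ereal (BLO_norm I0 f)"
    and "B > 0"
    and "lam > 0"
    and "proper_interval I"
    and "I \<subseteq> I0"
  shows "(let x\<^sub>I = lower_osc I f / ereal B; L = lam / B in
            0 \<le> x\<^sub>I \<and> x\<^sub>I \<le> 1 \<and>
            measure lebesgue {x \<in> I. ereal (f x) - ess_inf_on I f > ereal lam} / measure lebesgue I
              \<le> bellman (real_of_ereal x\<^sub>I) L)
       \<and> (\<forall>x L :: real. 0 \<le> x \<and> x \<le> 1 \<and> 0 < L \<longrightarrow>
            (L \<le> x \<longrightarrow> bellman x L = 1) \<and>
            (x < L \<and> L \<le> 1 \<longrightarrow> bellman x L = x / L) \<and>
            (1 \<le> L \<longrightarrow> bellman x L = x * exp (1 - L)) \<and>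
            (L = x \<longrightarrow> 1 = x / L) \<and>
            (L = 1 \<longrightarrow> x / L = x * exp (1 - L)))"
proof
  have normB: "BLO_norm I0 f = ereal B"
    using assms(3,4) by (cases "BLO_norm I0 f") auto
  have osc0: "lower_osc K f \<le> ereal B" if "proper_interval K" "K \<subseteq> I0" for K
    using that unfolding normB[symmetric] BLO_norm_def by (intro SUP_upper) auto
  have Im: "I \<in> lmeasurable" and Ipos: "measure lebesgue I > 0"
    using assms(6) proper_interval_lmeasurable by (auto simp: proper_interval_def)
  have f: "set_integrable lebesgue I f"
    using assms(2,7) Im set_integrable_subset[of lebesgue I0 f I] by (auto simp: BLO_def)
  obtain m where m: "ess_inf_on I f = ereal m"
    using ess_inf_on_le_mean_on[OF assms(6) f] osc0[OF assms(6,7)] unfolding lower_osc_def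
    by (cases "ess_inf_on I f") auto
  define x where "x = (mean_on I f - m) / B"
  define L where "L = lam / B"
  have xI: "lower_osc I f / ereal B = ereal x"
    using assms(4) by (simp add: lower_osc_def m x_def)
  have x: "0 \<le> x" "x \<le> 1"
    using ess_inf_on_le_mean_on[OF assms(6) f] osc0[OF assms(6,7)] assms(4)
    by (auto simp: lower_osc_def m x_def)
  define \<Phi> where "\<Phi> c = (LINT x:I|lebesgue. max 0 (f x - c))" for c
  define D where "D = measure lebesgue {x \<in> I. m + lam < f x}"
  have cheb: "D \<le> \<Phi> s / (m + lam - s)" if "s < m + lam" for s
    unfolding D_def \<Phi>_def using measure_superlevel_le[OF Im f that] .
  have \<Phi>m: "\<Phi> m = measure lebesgue I * (B * x)"
  proof -
    have "AE x in lebesgue. x \<in> I \<longrightarrow> m \<le> f x"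
      using ess_inf_on_AE[of I f] Im by (auto simp: m)
    moreover have "set_integrable lebesgue I (\<lambda>x. f x - m)" for m
      using f Im by (intro set_integral_diff) auto
    ultimately have "\<Phi> m = (LINT x:I|lebesgue. f x - m)"
      unfolding \<Phi>_def
      by (intro antisym set_integral_mono_AE set_integrable_excess[OF Im f]) auto
    also have "\<dots> = (LINT x:I|lebesgue. f x) - m * measure lebesgue I"
      using f Im by (subst set_integral_diff) (auto simp: set_integral_const_lmeasurable)
    also have "(LINT x:I|lebesgue. f x) = mean_on I f * measure lebesgue I"
      using Ipos by (simp add: mean_on_def)
    also have "mean_on I f = m + B * x"
      using assms(4) by (simp add: x_def)
    finally show ?thesis by (simp add: algebra_simps)
  qed
  have "D / measure lebesgue I \<le> x / q L"
  proof (cases "L \<le> 1")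
    case True
    have "D \<le> measure lebesgue I * (B * x) / lam"
      using cheb[of m] assms(5) \<Phi>m by simp
    then show ?thesis using True Ipos assms(4,5) by (simp add: q_def L_def field_simps)
  next
    case False
    then have "lam > B" using assms(4) by (simp add: L_def field_simps)
    \<comment> \<open>The level \<open>m + lam - B\<close> lies one unit \<open>B\<close> below the target, so Chebyshev costs the factor \<open>1 / B\<close>.\<close>
    then have "\<Phi> (m + lam - B) \<le> exp (- (lam - B) / B) * \<Phi> m"
      using excess_integral_decay[OF assms(6) f osc0, of m "m + lam - B"] assms(4,7) m
      by (simp add: \<Phi>_def algebra_simps)
    moreover have "- (lam - B) / B = - (L - 1)" using assms(4) by (simp add: L_def field_simps)
    ultimately have "\<Phi> (m + lam - B) \<le> exp (- (L - 1)) * (measure lebesgue I * (B * x))"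
      using \<Phi>m by simp
    moreover have "D * B \<le> \<Phi> (m + lam - B)"
      using cheb[of "m + lam - B"] assms(4) by (simp add: field_simps)
    ultimately have "D * B \<le> (exp (- (L - 1)) * measure lebesgue I * x) * B"
      by (simp add: mult_ac)
    then have "D \<le> exp (- (L - 1)) * measure lebesgue I * x"
      using assms(4) by simp
    then have "D / measure lebesgue I \<le> x * exp (- (L - 1))"
      using Ipos by (simp add: field_simps)
    also have "\<dots> = x / q L"
      using False by (simp add: q_def exp_diff)
    finally show ?thesis .
  qed
  moreover have "D \<le> measure lebesgue I"
    unfolding D_def using sets_superlevel(2)[OF fmeasurableD[OF Im] f]
    by (intro measure_mono_fmeasurable[OF _ _ Im]) auto
  ultimately have "D / measure lebesgue I \<le> bellman x L"
    using Ipos by (simp add: bellman_def)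
  moreover have "{x \<in> I. ereal (f x) - ess_inf_on I f > ereal lam} = {x \<in> I. m + lam < f x}"
    by (auto simp: m)
  ultimately show "let x\<^sub>I = lower_osc I f / ereal B; L = lam / B in
            0 \<le> x\<^sub>I \<and> x\<^sub>I \<le> 1 \<and>
            measure lebesgue {x \<in> I. ereal (f x) - ess_inf_on I f > ereal lam} / measure lebesgue I
              \<le> bellman (real_of_ereal x\<^sub>I) L"
    unfolding Let_def xI using x by (simp add: D_def L_def one_ereal_def)
next
  show "\<forall>x L :: real. 0 \<le> x \<and> x \<le> 1 \<and> 0 < L \<longrightarrow>
            (L \<le> x \<longrightarrow> bellman x L = 1) \<and>
            (x < L \<and> L \<le> 1 \<longrightarrow> bellman x L = x / L) \<and>
            (1 \<le> L \<longrightarrow> bellman x L = x * exp (1 - L)) \<and>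
            (L = x \<longrightarrow> 1 = x / L) \<and>
            (L = 1 \<longrightarrow> x / L = x * exp (1 - L))"
  proof (intro allI impI conjI)
    fix x L :: real assume x: "0 \<le> x \<and> x \<le> 1 \<and> 0 < L" and L: "1 \<le> L"
    have "q L = exp (L - 1)" using L by (cases "L = 1") (auto simp: q_def)
    then have "x / q L = x * exp (1 - L)" by (simp add: exp_diff)
    moreover have "x * exp (1 - L) \<le> 1" using x L by (intro mult_le_one) auto
    ultimately show "bellman x L = x * exp (1 - L)" by (simp add: bellman_def)
  qed (auto simp: bellman_def q_def field_simps)
qed

end
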